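(* For every integer $n\ge1$, $$f(n,10,4)=\delta(n,10,3)\qquad\text{and}\qquad f(n,13,4)=\delta(n,13,3).$$
   Context: A balanced $r$-partite graph with parts of size $n$ is a simple graph whose vertex set is partitioned into $r$ independent sets, each of size $n$. $f(n,r,t+1)$ denotes the largest possible minimum degree of a balanced $r$-partite graph with parts of size $n$ containing no copy of the complete graph $K_{t+1}$. $\delta(n,r,t)$ denotes the largest possible minimum degree of a balanced $r$-partite graph with parts of size $n$ and chromatic number at most $t$. *)

theory Defs
  imports Main "HOL-Library.Disjoint_Sets"
begin

text \<open>A simple graph is a finite vertex set \<open>V\<close> with a set \<open>E\<close> of two-element subsets of \<open>V\<close>.\<close>

definition simple_graph :: "'a set \<Rightarrow> 'a set set \<Rightarrow> bool" where
  "simple_graph V E \<longleftrightarrow> finite V \<and> (\<forall>e\<in>E. e \<subseteq> V \<and> card e = 2)"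

definition independent_set :: "'a set set \<Rightarrow> 'a set \<Rightarrow> bool" where
  "independent_set E A \<longleftrightarrow> (\<forall>u\<in>A. \<forall>v\<in>A. {u, v} \<notin> E)"

definition balanced_multipartite :: "nat \<Rightarrow> nat \<Rightarrow> 'a set \<Rightarrow> 'a set set \<Rightarrow> bool" where
  "balanced_multipartite n r V E \<longleftrightarrow> simple_graph V E \<and>
     (\<exists>P. partition_on V P \<and> card P = r \<and> (\<forall>A\<in>P. card A = n \<and> independent_set E A))"

definition vertex_degree :: "'a set set \<Rightarrow> 'a \<Rightarrow> nat" where
  "vertex_degree E v = card {u. {v, u} \<in> E}"

definition min_degree :: "'a set \<Rightarrow> 'a set set \<Rightarrow> nat" where
  "min_degree V E = Min (vertex_degree E ` V)"

text \<open>A copy of the complete graph \<open>K\<^sub>k\<close> is given by its vertex set: \<open>k\<close> pairwise adjacent vertices.\<close>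

definition contains_complete :: "nat \<Rightarrow> 'a set \<Rightarrow> 'a set set \<Rightarrow> bool" where
  "contains_complete k V E \<longleftrightarrow>
     (\<exists>S\<subseteq>V. finite S \<and> card S = k \<and> (\<forall>u\<in>S. \<forall>v\<in>S. u \<noteq> v \<longrightarrow> {u, v} \<in> E))"

definition colorable :: "nat \<Rightarrow> 'a set \<Rightarrow> 'a set set \<Rightarrow> bool" where
  "colorable k V E \<longleftrightarrow>
     (\<exists>c :: 'a \<Rightarrow> nat. c ` V \<subseteq> {..<k} \<and> (\<forall>u\<in>V. \<forall>v\<in>V. {u, v} \<in> E \<longrightarrow> c u \<noteq> c v))"

definition chromatic_number :: "'a set \<Rightarrow> 'a set set \<Rightarrow> nat" where
  "chromatic_number V E = (LEAST k. colorable k V E)"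

text \<open>
  The extremal functions range over graphs with vertices in \<open>nat\<close>, which up to isomorphism are
  all finite graphs. The third argument of \<open>f_extremal\<close>, as in \<open>f(n, r, t + 1)\<close>, is the order of
  the forbidden complete graph. Both maxima are over finite nonempty sets when \<open>n\<close> and \<open>r\<close> are
  positive and \<open>k \<ge> 2\<close>, respectively \<open>t \<ge> 1\<close>.
\<close>

definition f_extremal :: "nat \<Rightarrow> nat \<Rightarrow> nat \<Rightarrow> nat" where
  "f_extremal n r k = Max {min_degree V E | (V :: nat set) E.
     balanced_multipartite n r V E \<and> \<not> contains_complete k V E}"

definition \<delta>_extremal :: "nat \<Rightarrow> nat \<Rightarrow> nat \<Rightarrow> nat" where
  "\<delta>_extremal n r t = Max {min_degree V E | (V :: nat set) E.
     balanced_multipartite n r V E \<and> chromatic_number V E \<le> t}"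

end

theory Submission
  imports Defs
begin

text \<open>
  By the Andrasfai--Erdos--Sos theorem, a \<open>K\<^sub>4\<close>-free graph on \<open>r n\<close> vertices with minimum degree
  above \<open>5 r n / 8\<close> is 3-colorable, so it suffices to find, for \<open>r = 3 m + 4\<close> and \<open>m \<ge> 2\<close>, a balanced
  3-colorable graph with minimum degree at least \<open>\<lfloor>5 r n / 8\<rfloor>\<close>. Give each color \<open>m\<close> whole parts;
  of the four remaining parts, two put three quarters of their vertices in color 0, two put three
  quarters in color 1, and all remaining vertices get color 2. Joining all pairs of different parts
  and colors gives minimum degree \<open>(2 m + 3) n - \<lceil>3 n / 4\<rceil>\<close>, which is at least \<open>\<lfloor>5 r n / 8\<rfloor>\<close>
  when \<open>m \<ge> 2\<close>.
\<close>

section \<open>Degrees and weighted double counting\<close>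

lemma simple_graph_edgeD:
  assumes "simple_graph V E" "{u, v} \<in> E"
  shows "u \<in> V" "v \<in> V" "u \<noteq> v"
  using assms by (auto simp: simple_graph_def)

lemma simple_graph_loopless: "simple_graph V E \<Longrightarrow> {u} \<notin> E"
  by (auto simp: simple_graph_def)

lemma vertex_degree_eq:
  assumes "simple_graph V E"
  shows "vertex_degree E v = card {u \<in> V. {v, u} \<in> E}"
  unfolding vertex_degree_def using simple_graph_edgeD(2)[OF assms]
  by (intro arg_cong[where f = card]) auto

lemma min_degree_le:
  assumes "simple_graph V E" "v \<in> V"
  shows "min_degree V E \<le> vertex_degree E v"
  unfolding min_degree_def using assms by (simp add: simple_graph_def)

lemma min_degree_ge:
  assumes "simple_graph V E" "V \<noteq> {}" "\<And>v. v \<in> V \<Longrightarrow> d \<le> vertex_degree E v"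
  shows "d \<le> min_degree V E"
  unfolding min_degree_def using assms by (simp add: simple_graph_def)

lemma min_degree_le_card:
  assumes "simple_graph V E" "V \<noteq> {}"
  shows "min_degree V E \<le> card V"
proof -
  obtain v where v: "v \<in> V" using assms by auto
  have "vertex_degree E v \<le> card V"
    using assms(1) by (auto simp: vertex_degree_eq[OF assms(1)] simple_graph_def intro: card_mono)
  with min_degree_le[OF assms(1) v] show ?thesis by simp
qed

lemma min_degree_mono:
  assumes "simple_graph V E" "simple_graph V E'" "E \<subseteq> E'" "V \<noteq> {}"
  shows "min_degree V E \<le> min_degree V E'"
proof (rule min_degree_ge[OF assms(2,4)])
  fix v assume "v \<in> V"
  then have "min_degree V E \<le> vertex_degree E v"
    by (rule min_degree_le[OF assms(1)])
  also have "\<dots> \<le> vertex_degree E' v"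
    unfolding vertex_degree_eq[OF assms(1)] vertex_degree_eq[OF assms(2)]
    using assms by (intro card_mono) (auto simp: simple_graph_def)
  finally show "min_degree V E \<le> vertex_degree E' v" .
qed

text \<open>Double counting of adjacent pairs (entry of \<open>xs\<close>, vertex \<open>y\<close>).
  A list rather than a set is used so that repeated entries act as integer weights and coinciding
  vertices need no separate treatment.\<close>

lemma min_degree_times_length_le:
  assumes "simple_graph V E" "set xs \<subseteq> V"
    and "\<And>y. y \<in> V \<Longrightarrow> length (filter (\<lambda>x. {x, y} \<in> E) xs) \<le> c"
  shows "min_degree V E * length xs \<le> c * card V"
proof -
  have fin: "finite V" using assms(1) by (simp add: simple_graph_def)
  have "min_degree V E * length xs \<le> (\<Sum>x\<leftarrow>xs. vertex_degree E x)"
    using assms(2) by (induction xs) (auto simp: add_mono min_degree_le[OF assms(1)])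
  also have "\<dots> = (\<Sum>y\<in>V. length (filter (\<lambda>x. {x, y} \<in> E) xs))"
  proof (induction xs)
    case (Cons x xs)
    have "vertex_degree E x = (\<Sum>y\<in>V. if {x, y} \<in> E then 1 else 0)"
      using fin by (simp add: vertex_degree_eq[OF assms(1)] sum.If_cases Int_def)
    then show ?case
      using Cons by (auto simp: sum.distrib[symmetric] intro: sum.cong)
  qed simp
  also have "\<dots> \<le> (\<Sum>y\<in>V. c)"
    by (intro sum_mono assms(3))
  finally show ?thesis by (simp add: mult.commute)
qed

section \<open>Copies of the complete graph on four vertices and edge-maximal graphs\<close>

lemma contains_complete_4I:
  assumes "simple_graph V E"
    and "{a, b} \<in> E" "{a, c} \<in> E" "{a, d} \<in> E" "{b, c} \<in> E" "{b, d} \<in> E" "{c, d} \<in> E"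
  shows "contains_complete 4 V E"
  unfolding contains_complete_def
proof (intro exI[of _ "{a, b, c, d}"] conjI)
  \<comment> \<open>Distinctness comes for free: all six pairs are edges, and edges have two
    different ends.\<close>
  show "{a, b, c, d} \<subseteq> V" "card {a, b, c, d} = 4"
    using assms(2-) simple_graph_edgeD[OF assms(1)] by auto
  show "\<forall>u\<in>{a, b, c, d}. \<forall>v\<in>{a, b, c, d}. u \<noteq> v \<longrightarrow> {u, v} \<in> E"
    using assms(2-) by (auto simp: insert_commute)
qed simp

text \<open>A clique created by the new edge must use both its ends; the other two vertices of the
  clique are \<open>a\<close> and \<open>b\<close>, joined to each other and to \<open>u\<close> and
  \<open>w\<close> by old edges.\<close>

lemma contains_complete_insert_edgeE:
  assumes "\<not> contains_complete 4 V E" "contains_complete 4 V (insert {u, w} E)" "u \<noteq> w"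
  obtains a b where "{a, b} \<in> E" "{u, a} \<in> E" "{u, b} \<in> E" "{w, a} \<in> E" "{w, b} \<in> E"
proof -
  obtain S where S: "S \<subseteq> V" "finite S" "card S = 4"
    and adj: "\<forall>x\<in>S. \<forall>y\<in>S. x \<noteq> y \<longrightarrow> {x, y} \<in> insert {u, w} E"
    using assms(2) unfolding contains_complete_def by blast
  have uw: "u \<in> S" "w \<in> S"
    using assms(1) S adj unfolding contains_complete_def by (metis doubleton_eq_iff insertE)+
  have "card (S - {u, w}) = 2"
    using S uw assms(3) by (subst card_Diff_subset) auto
  then obtain a b where ab: "S - {u, w} = {a, b}" "a \<noteq> b"
    by (meson card_2_iff)
  then have "a \<in> S" "b \<in> S" "a \<noteq> u" "a \<noteq> w" "b \<noteq> u" "b \<noteq> w" by auto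
  with adj uw ab(2) show thesis
    by (intro that[of a b]) (auto simp: doubleton_eq_iff)
qed

lemma edge_maximal_extension:
  assumes "simple_graph V E" "\<not> contains_complete k V E"
  obtains E' where "simple_graph V E'" "E \<subseteq> E'" "\<not> contains_complete k V E'"
    "\<And>u v. u \<in> V \<Longrightarrow> v \<in> V \<Longrightarrow> u \<noteq> v \<Longrightarrow> {u, v} \<notin> E' \<Longrightarrow> contains_complete k V (insert {u, v} E')"
proof -
  let ?A = "{E'. simple_graph V E' \<and> \<not> contains_complete k V E'}"
  have "?A \<subseteq> Pow (Pow V)" "finite V" using assms(1) by (auto simp: simple_graph_def)
  then have "finite ?A" by (meson finite_Pow_iff finite_subset)
  then obtain M where M: "M \<in> ?A" "E \<subseteq> M" "\<forall>F\<in>?A. M \<subseteq> F \<longrightarrow> M = F"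
    using finite_has_maximal2[of ?A E] assms by auto
  have "contains_complete k V (insert {u, v} M)"
    if "u \<in> V" "v \<in> V" "u \<noteq> v" "{u, v} \<notin> M" for u v
  proof -
    have "simple_graph V (insert {u, v} M)"
      using that M(1) by (auto simp: simple_graph_def)
    with M(3) that(4) show ?thesis by blast
  qed
  with M show thesis by (intro that[of M]) auto
qed

section \<open>Colorings and the chromatic number\<close>

lemma colorable_subgraph: "colorable k V E' \<Longrightarrow> E \<subseteq> E' \<Longrightarrow> colorable k V E"
  unfolding colorable_def by (meson subsetD)

lemma colorable_mono:
  assumes "colorable k V E" "k \<le> l"
  shows "colorable l V E"
proof -
  have "{..<k} \<subseteq> {..<l}" using assms(2) by auto
  with assms(1) show ?thesis unfolding colorable_def by (meson subset_trans)
qed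

text \<open>The \<open>LEAST\<close> is attained because numbering the vertices injectively is a
  proper coloring; the rest is monotonicity in the number of colors.\<close>

lemma chromatic_number_le_iff:
  assumes "simple_graph V E"
  shows "chromatic_number V E \<le> k \<longleftrightarrow> colorable k V E"
proof
  have "finite V" using assms by (simp add: simple_graph_def)
  then obtain h :: "'a \<Rightarrow> nat" where h: "bij_betw h V {0..<card V}"
    using ex_bij_betw_finite_nat by blast
  have "colorable (card V) V E"
    unfolding colorable_def
  proof (intro exI[of _ h] conjI ballI impI)
    show "h ` V \<subseteq> {..<card V}" using h by (auto simp: bij_betw_def)
    show "h u \<noteq> h v" if "u \<in> V" "v \<in> V" "{u, v} \<in> E" for u v
      using h that simple_graph_edgeD(3)[OF assms that(3)] by (auto simp: bij_betw_def inj_on_def)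
  qed
  then have "colorable (chromatic_number V E) V E"
    unfolding chromatic_number_def by (rule LeastI)
  then show "colorable k V E" if "chromatic_number V E \<le> k"
    using that colorable_mono by blast
  show "chromatic_number V E \<le> k" if "colorable k V E"
    unfolding chromatic_number_def using that by (rule Least_le)
qed

lemma colorable_imp_not_contains_complete:
  assumes "colorable k V E" "k < l"
  shows "\<not> contains_complete l V E"
proof
  assume "contains_complete l V E"
  then obtain S where S: "S \<subseteq> V" "card S = l" "\<forall>u\<in>S. \<forall>v\<in>S. u \<noteq> v \<longrightarrow> {u, v} \<in> E"
    unfolding contains_complete_def by blast
  obtain c :: "'a \<Rightarrow> nat" where c: "c ` V \<subseteq> {..<k}" "\<forall>u\<in>V. \<forall>v\<in>V. {u, v} \<in> E \<longrightarrow> c u \<noteq> c v"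
    using assms(1) unfolding colorable_def by blast
  have "inj_on c S" using S c(2) by (meson inj_onI subsetD)
  then have "card S \<le> card {..<k}"
    using S(1) c(1) by (intro card_inj_on_le) auto
  with S(2) assms(2) show False by simp
qed

text \<open>Such a graph is complete multipartite. A maximal clique \<open>S\<close> has a
  representative in every class and at most \<open>k\<close> vertices, so sending each vertex to its
  representative gives the coloring.\<close>

lemma colorable_if_nonadjacency_transitive:
  assumes "simple_graph V E" "\<not> contains_complete (Suc k) V E"
    and trans: "\<And>u v w. u \<in> V \<Longrightarrow> v \<in> V \<Longrightarrow> w \<in> V \<Longrightarrow> {u, w} \<notin> E \<Longrightarrow> {w, v} \<notin> E \<Longrightarrow> {u, v} \<notin> E"
  shows "colorable k V E"
proof -
  let ?A = "{S. S \<subseteq> V \<and> (\<forall>u\<in>S. \<forall>v\<in>S. u \<noteq> v \<longrightarrow> {u, v} \<in> E)}"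
  have fin: "finite V" using assms(1) by (simp add: simple_graph_def)
  then have "finite ?A" by simp
  moreover have "{} \<in> ?A" by simp
  ultimately obtain S where S: "S \<in> ?A" and max: "\<forall>T\<in>?A. S \<subseteq> T \<longrightarrow> S = T"
    using finite_has_maximal2[of ?A "{}"] by auto
  have finS: "finite S" using S fin finite_subset by auto
  have "card S \<le> k"
  proof (rule ccontr)
    assume "\<not> card S \<le> k"
    then obtain T where T: "T \<subseteq> S" "card T = Suc k" "finite T"
      using obtain_subset_with_card_n[of "Suc k" S] by auto
    then have "T \<subseteq> V" "\<forall>u\<in>T. \<forall>v\<in>T. u \<noteq> v \<longrightarrow> {u, v} \<in> E" using S by auto
    with T assms(2) show False by (auto simp: contains_complete_def)
  qed
  obtain h :: "'a \<Rightarrow> nat" where h: "bij_betw h S {0..<card S}"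
    using ex_bij_betw_finite_nat finS by blast
  \<comment> \<open>A vertex joined to all of \<open>S\<close> would lie in \<open>S\<close> by
    maximality and so be a loop. A vertex of \<open>S\<close> may be its own representative.\<close>
  have "\<exists>s\<in>S. {x, s} \<notin> E" if "x \<in> V" for x
  proof (rule ccontr)
    assume *: "\<not> (\<exists>s\<in>S. {x, s} \<notin> E)"
    then have "insert x S \<in> ?A" using S that by (auto simp: insert_commute)
    then have "S \<subseteq> insert x S \<longrightarrow> S = insert x S" using max by (rule bspec[rotated])
    then have "x \<in> S" by blast
    then have "{x, x} \<in> E" using * by blast
    then show False using simple_graph_loopless[OF assms(1)] by simp
  qed
  then obtain g where g: "\<And>x. x \<in> V \<Longrightarrow> g x \<in> S \<and> {x, g x} \<notin> E" by metis
  show ?thesis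
    unfolding colorable_def
  proof (intro exI[of _ "h \<circ> g"] conjI ballI impI)
    show "(h \<circ> g) ` V \<subseteq> {..<k}"
    proof
      fix i assume "i \<in> (h \<circ> g) ` V"
      then have "i \<in> h ` S" using g by auto
      then show "i \<in> {..<k}" using h \<open>card S \<le> k\<close> by (auto simp: bij_betw_def)
    qed
    show "(h \<circ> g) u \<noteq> (h \<circ> g) v" if uv: "u \<in> V" "v \<in> V" "{u, v} \<in> E" for u v
    proof
      assume "(h \<circ> g) u = (h \<circ> g) v"
      then have "g u = g v" using g uv h by (auto simp: bij_betw_def inj_on_def)
      moreover have "g u \<in> V" using g[OF uv(1)] S by auto
      ultimately have "{u, v} \<notin> E"
        using trans[of u v "g u"] g[OF uv(1)] g[OF uv(2)] uv by (simp add: insert_commute)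
      then show False using uv(3) by contradiction
    qed
  qed
qed

section \<open>The Andrasfai--Erdos--Sos theorem for forbidden cliques of order four\<close>

lemma min_degree_le_if_wheel:
  assumes G: "simple_graph V E" and K4: "\<not> contains_complete 4 V E"
    and hub: "{h, a} \<in> E" "{h, b} \<in> E" "{h, c} \<in> E" "{h, d} \<in> E" "{h, e} \<in> E"
    and rim: "{a, b} \<in> E" "{b, c} \<in> E" "{c, d} \<in> E" "{d, e} \<in> E" "{e, a} \<in> E"
  shows "8 * min_degree V E \<le> 5 * card V"
proof -
  \<comment> \<open>With weight 3 on the hub and 1 on the rim, every neighbourhood weighs at most 5 of the total 8.\<close>
  have "min_degree V E * length [h, h, h, a, b, c, d, e] \<le> 5 * card V"
  proof (rule min_degree_times_length_le[OF G])
    show "set [h, h, h, a, b, c, d, e] \<subseteq> V"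
      using hub simple_graph_edgeD[OF G] by auto
    fix y
    have "\<not> ({h, y} \<in> E \<and> {p, y} \<in> E \<and> {q, y} \<in> E)"
      if "{h, p} \<in> E" "{h, q} \<in> E" "{p, q} \<in> E" for p q
      using contains_complete_4I[OF G, of h p q y] K4 that by blast
    \<comment> \<open>A neighbor of \<open>h\<close> sees no two consecutive rim vertices, hence at
      most two of the 5-cycle, and scores at most 3 + 2. Any other vertex sees at most the five rim
      vertices.\<close>
    with hub rim show "length (filter (\<lambda>x. {x, y} \<in> E) [h, h, h, a, b, c, d, e]) \<le> 5"
      by (cases "{h, y} \<in> E") (auto split: if_splits)
  qed
  then show ?thesis by simp
qed

text \<open>
  In an edge-maximal counterexample some \<open>w\<close> is adjacent to neither end of an edge \<open>u v\<close>, and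
  maximality gives edges \<open>a a'\<close> in \<open>N(u) \<inter> N(w)\<close> and \<open>b b'\<close> in \<open>N(v) \<inter> N(w)\<close>. Without 5-wheels, every
  vertex has at most four neighbours among these seven vertices. They need not be distinct, so
  they are counted as a list.
\<close>
theorem Andrasfai_Erdos_Sos_4:
  assumes G: "simple_graph V E" and K4: "\<not> contains_complete 4 V E"
    and deg: "5 * card V < 8 * min_degree V E"
  shows "colorable 3 V E"
proof (cases "V = {}")
  case True
  then show ?thesis by (simp add: colorable_def)
next
  case False
  obtain E' where G': "simple_graph V E'" and sub: "E \<subseteq> E'" and K4': "\<not> contains_complete 4 V E'"
    and max: "\<And>u v. u \<in> V \<Longrightarrow> v \<in> V \<Longrightarrow> u \<noteq> v \<Longrightarrow> {u, v} \<notin> E' \<Longrightarrow>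
        contains_complete 4 V (insert {u, v} E')"
    using edge_maximal_extension[OF G K4] by blast
  have deg': "5 * card V < 8 * min_degree V E'"
    using deg min_degree_mono[OF G G' sub False] by simp
  have no_K4: False
    if "{a, b} \<in> E'" "{a, c} \<in> E'" "{a, d} \<in> E'" "{b, c} \<in> E'" "{b, d} \<in> E'" "{c, d} \<in> E'" for a b c d
    using contains_complete_4I[OF G' that] K4' by blast
  \<comment> \<open>Nonadjacency in \<open>E'\<close> is shown to be transitive, which makes
    \<open>E'\<close> and hence \<open>E\<close> 3-colorable.\<close>
  have "{u, v} \<notin> E'"
    if V: "u \<in> V" "v \<in> V" "w \<in> V" and wu: "{u, w} \<notin> E'" and wv: "{w, v} \<notin> E'" for u v w
  proof
    assume uv: "{u, v} \<in> E'"
    have "u \<noteq> w" "v \<noteq> w" using uv wu wv by (auto simp: insert_commute)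
    obtain a a' where a: "{a, a'} \<in> E'" "{u, a} \<in> E'" "{u, a'} \<in> E'" "{w, a} \<in> E'" "{w, a'} \<in> E'"
      using contains_complete_insert_edgeE[OF K4' max[OF V(1,3) \<open>u \<noteq> w\<close> wu] \<open>u \<noteq> w\<close>] .
    have "{v, w} \<notin> E'" using wv by (simp add: insert_commute)
    then obtain b b' where b: "{b, b'} \<in> E'" "{v, b} \<in> E'" "{v, b'} \<in> E'" "{w, b} \<in> E'" "{w, b'} \<in> E'"
      using contains_complete_insert_edgeE[OF K4' max[OF V(2,3) \<open>v \<noteq> w\<close>] \<open>v \<noteq> w\<close>] by blast
    \<comment> \<open>The excluded wheel has hub \<open>y\<close> and rim \<open>w p u v q\<close>,
      closed up by the edge \<open>u v\<close>.\<close>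
    have no_wheel: "\<not> ({w, y} \<in> E' \<and> {p, y} \<in> E' \<and> {u, y} \<in> E' \<and> {v, y} \<in> E' \<and> {q, y} \<in> E')"
      if "{w, p} \<in> E'" "{u, p} \<in> E'" "{v, q} \<in> E'" "{w, q} \<in> E'" for p q y
      using min_degree_le_if_wheel[OF G' K4', of y w p u v q] that deg' uv
      by (auto simp: insert_commute)
    have "min_degree V E' * length [u, v, w, a, a', b, b'] \<le> 4 * card V"
    proof (rule min_degree_times_length_le[OF G'])
      show "set [u, v, w, a, a', b, b'] \<subseteq> V"
        using V a b simple_graph_edgeD[OF G'] by auto
      fix y
      have "\<not> ({u, y} \<in> E' \<and> {a, y} \<in> E' \<and> {a', y} \<in> E')"
        "\<not> ({w, y} \<in> E' \<and> {a, y} \<in> E' \<and> {a', y} \<in> E')"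
        "\<not> ({v, y} \<in> E' \<and> {b, y} \<in> E' \<and> {b', y} \<in> E')"
        "\<not> ({w, y} \<in> E' \<and> {b, y} \<in> E' \<and> {b', y} \<in> E')"
        using no_K4[of u a a' y] no_K4[of w a a' y] no_K4[of v b b' y] no_K4[of w b b' y] a b
        by blast+
      moreover have
        "\<not> ({w, y} \<in> E' \<and> {a, y} \<in> E' \<and> {u, y} \<in> E' \<and> {v, y} \<in> E' \<and> {b, y} \<in> E')"
        "\<not> ({w, y} \<in> E' \<and> {a, y} \<in> E' \<and> {u, y} \<in> E' \<and> {v, y} \<in> E' \<and> {b', y} \<in> E')"
        "\<not> ({w, y} \<in> E' \<and> {a', y} \<in> E' \<and> {u, y} \<in> E' \<and> {v, y} \<in> E' \<and> {b, y} \<in> E')"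
        "\<not> ({w, y} \<in> E' \<and> {a', y} \<in> E' \<and> {u, y} \<in> E' \<and> {v, y} \<in> E' \<and> {b', y} \<in> E')"
        using no_wheel[of a b y] no_wheel[of a b' y] no_wheel[of a' b y] no_wheel[of a' b' y] a b
        by blast+
      \<comment> \<open>If \<open>y\<close> is not joined to \<open>w\<close>, it sees at most two
        of \<open>u, a, a'\<close> and two of \<open>v, b, b'\<close>. If it is, it sees at most one
        of \<open>a, a'\<close> and one of \<open>b, b'\<close>, so a score of five would need
        \<open>u\<close>, \<open>v\<close>, \<open>w\<close> and one of each pair, which is a
        wheel.\<close>
      ultimately show "length (filter (\<lambda>x. {x, y} \<in> E') [u, v, w, a, a', b, b']) \<le> 4"
        by (cases "{w, y} \<in> E'"; cases "{u, y} \<in> E'"; cases "{v, y} \<in> E'";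
            cases "{a, y} \<in> E'"; cases "{a', y} \<in> E'"; cases "{b, y} \<in> E'"; cases "{b', y} \<in> E'")
          simp_all
    qed
    \<comment> \<open>The count gives minimum degree at most 4/7 of \<open>card V\<close>, and 4/7 <
      5/8.\<close>
    with deg' show False by simp
  qed
  moreover have "\<not> contains_complete (Suc 3) V E'" using K4' by simp
  ultimately have "colorable 3 V E'"
    using colorable_if_nonadjacency_transitive[OF G'] by blast
  then show ?thesis using sub by (rule colorable_subgraph)
qed

section \<open>Balanced 3-colorable graphs of large minimum degree\<close>

lemma card_balanced_multipartite:
  assumes "balanced_multipartite n r V E"
  shows "card V = r * n"
proof -
  obtain P where P: "partition_on V P" "card P = r" "\<forall>A\<in>P. card A = n" and fin: "finite V"
    using assms by (auto simp: balanced_multipartite_def simple_graph_def)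
  have "card V = (\<Sum>A\<in>P. card A)"
    using P(1) fin by (intro product_partition) (auto dest: partition_onD1 intro: finite_subset)
  with P show ?thesis by simp
qed

text \<open>Vertex \<open>v\<close> is encoded as position \<open>v mod n\<close> in part
  \<open>v div n\<close>. The first \<open>3 * m\<close> parts are monochromatic; the last four are
  mixed and change color at position \<open>x\<close>.\<close>

definition split_color :: "nat \<Rightarrow> nat \<Rightarrow> nat \<Rightarrow> nat \<Rightarrow> nat" where
  "split_color m n x v =
     (if v div n < 3 * m then v div n div m else if x \<le> v mod n then 2 else (v div n - 3 * m) div 2)"

definition split_graph :: "nat \<Rightarrow> nat \<Rightarrow> nat \<Rightarrow> nat set set" where
  "split_graph m n x = {{u, v} | u v. u < (3 * m + 4) * n \<and> v < (3 * m + 4) * n \<and>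
     u div n \<noteq> v div n \<and> split_color m n x u \<noteq> split_color m n x v}"

lemma split_graph_iff:
  "{u, v} \<in> split_graph m n x \<longleftrightarrow> u < (3 * m + 4) * n \<and> v < (3 * m + 4) * n \<and>
     u div n \<noteq> v div n \<and> split_color m n x u \<noteq> split_color m n x v"
  unfolding split_graph_def by (auto simp: doubleton_eq_iff)

lemma simple_split_graph: "simple_graph {..<(3 * m + 4) * n} (split_graph m n x)"
proof -
  have "card {u, v} = 2" if "u div n \<noteq> v div n" for u v
    using that by (auto simp: card_insert_if)
  then show ?thesis unfolding simple_graph_def split_graph_def by auto
qed

lemma colorable_split_graph:
  assumes "m > 0"
  shows "colorable 3 {..<(3 * m + 4) * n} (split_graph m n x)"
  unfolding colorable_def
proof (intro exI[of _ "split_color m n x"] conjI ballI impI)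
  show "split_color m n x ` {..<(3 * m + 4) * n} \<subseteq> {..<3}"
  proof
    fix k assume "k \<in> split_color m n x ` {..<(3 * m + 4) * n}"
    then obtain v where v: "v < (3 * m + 4) * n" "k = split_color m n x v" by auto
    then have "v div n < 3 * m + 4" by (simp add: less_mult_imp_div_less)
    then show "k \<in> {..<3}"
      using assms by (auto simp: v(2) split_color_def less_mult_imp_div_less)
  qed
qed (simp add: split_graph_iff)

lemma balanced_multipartite_split_graph:
  assumes "n > 0"
  shows "balanced_multipartite n (3 * m + 4) {..<(3 * m + 4) * n} (split_graph m n x)"
proof -
  define part where "part i = {i * n..<Suc i * n}" for i
  have part_iff: "v \<in> part i \<longleftrightarrow> v div n = i" for v i
    using assms by (auto simp: part_def div_nat_eqI less_mult_imp_div_less mult.commute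
        dividend_less_times_div intro: div_times_less_eq_dividend)
  have "part i \<noteq> {}" for i using assms by (auto simp: part_def)
  have inj: "inj_on part {..<3 * m + 4}"
    using assms by (intro inj_onI) (metis part_iff \<open>\<And>i. part i \<noteq> {}\<close> ex_in_conv)
  have "partition_on {..<(3 * m + 4) * n} (part ` {..<3 * m + 4})"
  proof (rule partition_onI)
    show "\<Union> (part ` {..<3 * m + 4}) = {..<(3 * m + 4) * n}"
      using assms by (auto simp: part_iff div_less_iff_less_mult)
  qed (use \<open>\<And>i. part i \<noteq> {}\<close> in \<open>auto simp: disjnt_iff part_iff\<close>)
  moreover have "card (part ` {..<3 * m + 4}) = 3 * m + 4"
    using inj by (simp add: card_image)
  moreover have "card (part i) = n \<and> independent_set (split_graph m n x) (part i)" for i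
    by (auto simp: independent_set_def split_graph_iff part_iff) (simp add: part_def)
  ultimately show ?thesis
    unfolding balanced_multipartite_def using simple_split_graph by blast
qed

text \<open>\<open>A\<close> holds the monochromatic parts of color \<open>k\<close>,
  \<open>B\<close> the mixed parts meeting it, and \<open>X\<close> the positions it takes there.
  The factor \<open>card B - 1\<close> counts the mixed parts other than that of a given vertex. The
  two lower bounds on \<open>y\<close> treat colors 0 and 1 (two parts, \<open>x\<close> positions)
  and color 2 (four parts, \<open>n - x\<close> positions).\<close>

lemma split_color_class:
  assumes "m > 0" "x \<le> n" "x \<le> y" "3 * (n - x) \<le> y"
  obtains A B :: "nat set" and X
  where "finite A" "card A = m" "finite B" "B \<noteq> {}" "X \<subseteq> {..<n}" "(card B - 1) * card X \<le> y"
    "\<And>u. u < (3 * m + 4) * n \<Longrightarrow> split_color m n x u = k \<Longrightarrow>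
       u div n \<in> A \<or> u div n \<in> B \<and> u mod n \<in> X"
proof -
  define A where "A = {k * m..<Suc k * m}"
  have A: "u div n \<in> A" if "u div n div m = k" for u
    using assms(1) that by (auto simp: A_def mult.commute dividend_less_times_div)
  have part_less: "u div n < 3 * m + 4" if "u < (3 * m + 4) * n" for u
    using that by (simp add: less_mult_imp_div_less)
  have mod_less: "u mod n < n" if "u < (3 * m + 4) * n" for u
    using that by (cases n) auto
  show thesis
  proof (cases "k = 2")
    case True
    show thesis
    proof (rule that[of A "{3 * m..<3 * m + 4}" "{x..<n}"])
      fix u assume u: "u < (3 * m + 4) * n" "split_color m n x u = k"
      from part_less[OF u(1)] have "u div n - 3 * m < 4" by simp
      \<comment> \<open>Before the cut at \<open>x\<close> only colors 0 and 1 occur, so color 2 in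
        a mixed part forces a position from \<open>x\<close> on.\<close>
      then have "(u div n - 3 * m) div 2 < 2" by (simp add: less_mult_imp_div_less)
      then show "u div n \<in> A \<or> u div n \<in> {3 * m..<3 * m + 4} \<and> u mod n \<in> {x..<n}"
        using u(2) A[of u] part_less[OF u(1)] mod_less[OF u(1)] True
        by (auto simp: split_color_def split: if_splits)
    qed (use assms in \<open>auto simp: A_def\<close>)
  next
    case False
    show thesis
    proof (rule that[of A "{3 * m + 2 * k..<3 * m + 2 * k + 2}" "{..<x}"])
      fix u assume u: "u < (3 * m + 4) * n" "split_color m n x u = k"
      then show "u div n \<in> A \<or> u div n \<in> {3 * m + 2 * k..<3 * m + 2 * k + 2} \<and> u mod n \<in> {..<x}"
        using A[of u] False by (auto simp: split_color_def split: if_splits)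
    qed (use assms in \<open>auto simp: A_def\<close>)
  qed
qed

lemma card_split_nonadjacent_le:
  assumes "m > 0" "x \<le> n" "x \<le> y" "3 * (n - x) \<le> y" "v < (3 * m + 4) * n"
  shows "card {u. u < (3 * m + 4) * n \<and> (u div n = v div n \<or> split_color m n x u = split_color m n x v)}
    \<le> (m + 1) * n + y" (is "card ?N \<le> _")
proof -
  obtain A B :: "nat set" and X where ABX: "finite A" "card A = m" "finite B" "B \<noteq> {}" "X \<subseteq> {..<n}"
      "(card B - 1) * card X \<le> y"
    and cover: "\<And>u. u < (3 * m + 4) * n \<Longrightarrow> split_color m n x u = split_color m n x v \<Longrightarrow>
       u div n \<in> A \<or> u div n \<in> B \<and> u mod n \<in> X"
    using split_color_class[OF assms(1-4), of "split_color m n x v"] by metis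
  let ?i = "v div n"
  \<comment> \<open>The part of \<open>v\<close> is counted whole, so it is removed from
    \<open>B\<close> to avoid counting it twice.\<close>
  let ?T = "insert ?i A \<times> {..<n} \<union> (B - {?i}) \<times> X"
  have X: "finite X" "card X \<le> n"
    using ABX(5) finite_subset card_mono[of "{..<n}" X] by auto
  have "?N \<subseteq> (\<lambda>(i, p). i * n + p) ` ?T"
  proof
    fix u assume u: "u \<in> ?N"
    then have "u mod n < n" by (cases n) auto
    with u cover[of u] have "(u div n, u mod n) \<in> ?T" by auto
    then show "u \<in> (\<lambda>(i, p). i * n + p) ` ?T"
      by (intro image_eqI[of _ _ "(u div n, u mod n)"]) auto
  qed
  then have "card ?N \<le> card ?T"
    using ABX X by (intro surj_card_le) auto
  also have "\<dots> \<le> card (insert ?i A) * n + card (B - {?i}) * card X"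
    using card_Un_le[of "insert ?i A \<times> {..<n}" "(B - {?i}) \<times> X"]
    by (simp add: card_cartesian_product)
  also have "\<dots> \<le> (m + 1) * n + y"
  proof (cases "?i \<in> A")
    \<comment> \<open>Here \<open>v\<close> lies in a monochromatic part, already among the
      \<open>m\<close> parts of \<open>A\<close>. The spare \<open>n\<close> pays for one copy of
      \<open>X\<close>, and \<open>y\<close> for the other \<open>card B - 1\<close>.\<close>
    case True
    have "card (B - {?i}) * card X \<le> card B * card X"
      using ABX by (intro mult_right_mono card_mono) auto
    also have "\<dots> = card X + (card B - 1) * card X"
      using ABX by (cases "card B") auto
    also have "\<dots> \<le> n + y" using ABX X by simp
    finally show ?thesis using True ABX by (simp add: insert_absorb)
  next
    \<comment> \<open>Here the part of \<open>v\<close> is mixed: it is the extra whole part, and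
      \<open>card B - 1\<close> copies of \<open>X\<close> remain.\<close>
    case False
    then have "?i \<in> B" using cover[OF assms(5)] by simp
    then have "card (B - {?i}) = card B - 1" using ABX by simp
    then show ?thesis using False ABX by simp
  qed
  finally show ?thesis .
qed

lemma min_degree_split_graph_ge:
  assumes "m > 0" "n > 0" "x \<le> n" "x \<le> y" "3 * (n - x) \<le> y"
  shows "(2 * m + 3) * n - y \<le> min_degree {..<(3 * m + 4) * n} (split_graph m n x)"
proof (rule min_degree_ge[OF simple_split_graph])
  have "0 \<in> {..<(3 * m + 4) * n}" using assms by simp
  then show "{..<(3 * m + 4) * n} \<noteq> {}" by blast
  fix v assume "v \<in> {..<(3 * m + 4) * n}"
  then have v: "v < (3 * m + 4) * n" by simp
  let ?N = "{u. u < (3 * m + 4) * n \<and> (u div n = v div n \<or> split_color m n x u = split_color m n x v)}"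
  have "{u \<in> {..<(3 * m + 4) * n}. {v, u} \<in> split_graph m n x} = {..<(3 * m + 4) * n} - ?N"
    using v by (auto simp: split_graph_iff)
  then have "vertex_degree (split_graph m n x) v = card ({..<(3 * m + 4) * n} - ?N)"
    by (simp add: vertex_degree_eq[OF simple_split_graph])
  also have "\<dots> = (3 * m + 4) * n - card ?N"
    by (subst card_Diff_subset) auto
  finally show "(2 * m + 3) * n - y \<le> vertex_degree (split_graph m n x) v"
    using card_split_nonadjacent_le[OF assms(1,3,4,5) v] by (simp add: algebra_simps)
qed

lemma exists_colorable_min_degree_ge:
  assumes "n > 0" "m \<ge> 2" "8 * d \<le> 5 * ((3 * m + 4) * n)"
  obtains V :: "nat set" and E where "balanced_multipartite n (3 * m + 4) V E" "colorable 3 V E"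
    "d \<le> min_degree V E"
proof -
  \<comment> \<open>This is 3n/4 rounded up, the least \<open>x\<close> with
    \<open>3 * (n - x) \<le> x\<close>; thus \<open>y = x\<close> serves all colors.\<close>
  define x where "x = (3 * n + 3) div 4"
  have x: "x \<le> n" "3 * (n - x) \<le> x" using assms(1) by (auto simp: x_def)
  have "4 * x \<le> 3 * n + 3" by (simp add: x_def)
  moreover have "2 * n \<le> m * n" using assms(2) by simp
  moreover have "8 * d \<le> 15 * (m * n) + 20 * n" "(2 * m + 3) * n = 2 * (m * n) + 3 * n"
    using assms(3) by (simp_all add: algebra_simps)
  \<comment> \<open>Eight times the right side is at least \<open>16 * m * n + 18 * n - 6\<close>,
    which by \<open>m \<ge> 2\<close> is at least \<open>8 * d - 6\<close>. The loss 6 is below 8,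
    so integrality gives the bound.\<close>
  ultimately have "d \<le> (2 * m + 3) * n - x" by linarith
  also have "\<dots> \<le> min_degree {..<(3 * m + 4) * n} (split_graph m n x)"
    using assms x by (intro min_degree_split_graph_ge) auto
  finally show thesis
    using that balanced_multipartite_split_graph[OF assms(1)] colorable_split_graph assms(2)
    by (metis gr0I not_numeral_le_zero)
qed

section \<open>Equality of the two extremal functions\<close>

theorem f_extremal_eq_\<delta>_extremal:
  assumes "n > 0" "m \<ge> 2"
  shows "f_extremal n (3 * m + 4) 4 = \<delta>_extremal n (3 * m + 4) 3"
proof -
  let ?r = "3 * m + 4"
  define F where "F = {min_degree V E | (V :: nat set) E.
    balanced_multipartite n ?r V E \<and> \<not> contains_complete 4 V E}"
  define D where "D = {min_degree V E | (V :: nat set) E.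
    balanced_multipartite n ?r V E \<and> chromatic_number V E \<le> 3}"
  have simple: "simple_graph V E" and nonempty: "V \<noteq> {}"
    if "balanced_multipartite n ?r V E" for V :: "nat set" and E
    using that card_balanced_multipartite[OF that] assms by (auto simp: balanced_multipartite_def)
  have D_I: "min_degree V E \<in> D" if "balanced_multipartite n ?r V E" "colorable 3 V E" for V :: "nat set" and E
    using that chromatic_number_le_iff[OF simple[OF that(1)], of 3] unfolding D_def by blast
  have sub: "D \<subseteq> F"
  proof
    fix d assume "d \<in> D"
    then obtain V :: "nat set" and E where VE: "d = min_degree V E" "balanced_multipartite n ?r V E"
        and "chromatic_number V E \<le> 3"
      unfolding D_def by blast
    then have "colorable 3 V E" using chromatic_number_le_iff[OF simple[OF VE(2)]] by blast
    with VE colorable_imp_not_contains_complete[of 3 V E 4] show "d \<in> F"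
      by (auto simp: F_def)
  qed
  \<comment> \<open>Infinitely many graphs on \<open>nat\<close> compete, but their minimum degrees
    are bounded, so both maxima are over finite sets.\<close>
  have "F \<subseteq> {..?r * n}"
  proof
    fix d assume "d \<in> F"
    then obtain V :: "nat set" and E where VE: "d = min_degree V E" "balanced_multipartite n ?r V E"
      unfolding F_def by blast
    with min_degree_le_card[OF simple nonempty] card_balanced_multipartite show "d \<in> {..?r * n}"
      by (metis atMost_iff)
  qed
  then have finF: "finite F" using finite_subset by blast
  then have finD: "finite D" using sub finite_subset by blast
  \<comment> \<open>A 3-colorable graph competes in \<open>D\<close> itself; any other has minimum
    degree at most 5/8 of its order, which the construction reaches.\<close>
  have cofinal: "\<exists>d'\<in>D. d \<le> d'" if dF: "d \<in> F" for d
  proof -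
    obtain V :: "nat set" and E where VE: "d = min_degree V E" "balanced_multipartite n ?r V E"
        "\<not> contains_complete 4 V E"
      using dF by (auto simp: F_def)
    show ?thesis
    proof (cases "colorable 3 V E")
      case True
      with D_I VE show ?thesis by blast
    next
      case False
      then have "8 * d \<le> 5 * (?r * n)"
        using Andrasfai_Erdos_Sos_4[OF simple[OF VE(2)] VE(3)] VE(1)
          card_balanced_multipartite[OF VE(2)] by linarith
      then show ?thesis
        using exists_colorable_min_degree_ge[OF assms] D_I by metis
    qed
  qed
  have "D \<noteq> {}"
    using exists_colorable_min_degree_ge[OF assms, of 0] D_I by auto
  then have "Max F = Max D"
    using sub finF finD cofinal
    by (intro antisym Max_mono Max.boundedI) (auto simp: Max_ge_iff)
  then show ?thesis unfolding f_extremal_def \<delta>_extremal_def F_def D_def .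
qed

theorem proposition5p2:
  fixes n :: nat
  assumes "n \<ge> 1"
  shows "f_extremal n 10 4 = \<delta>_extremal n 10 3 \<and> f_extremal n 13 4 = \<delta>_extremal n 13 3"
  using f_extremal_eq_\<delta>_extremal[of n 2] f_extremal_eq_\<delta>_extremal[of n 3] assms by simp

end
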